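(* Let $(X,\mathcal{T}_1,\mathcal{T}_2,E)$ be a bi-soft topological space over $X$ and let $Y$ be a non-empty subset of $X$. If $(X,\mathcal{T}_1,\mathcal{T}_2,E)$ is a pair-wise soft $T_0$-space, then $(Y,\mathcal{T}_{1Y},\mathcal{T}_{2Y},E)$ is also a pair-wise soft $T_0$-space.
   Context: $X$ is a set (initial universe) and $E$ is a non-empty set of parameters. A soft set $(F,E)$ over $X$ is a map $F:E\to\mathcal{P}(X)$, where $\mathcal{P}(X)$ is the power set of $X$. Unions and intersections of soft sets are taken parameterwise. $\Phi$ denotes the soft set with value $\emptyset$ at every $e\in E$ and $\widetilde{X}$ the soft set with value $X$ at every $e\in E$. For $x\in X$, $x\in(F,E)$ means $x\in F(e)$ for all $e\in E$ (so $x\notin(F,E)$ means $x\notin F(e)$ for some $e\in E$). A soft topology on $X$ is a collection $\mathcal{T}$ of soft sets over $X$ (with parameter set $E$) containing $\Phi$ and $\widetilde{X}$ and closed under arbitrary unions and under intersections of two members; its members are called soft open. A bi-soft topological space $(X,\mathcal{T}_1,\mathcal{T}_2,E)$ consists of two soft topologies $\mathcal{T}_1,\mathcal{T}_2$ on $X$ with the same parameter set $E$. For a non-empty $Y\subseteq X$ and a soft set $(F,E)$ over $X$, $({}^YF,E)$ is the soft set with ${}^YF(e)=Y\cap F(e)$ for all $e\in E$. The soft relative topology is $\mathcal{T}_{iY}=\{({}^YF,E)\mid(F,E)\in\mathcal{T}_i\}$, a soft topology on $Y$, and $(Y,\mathcal{T}_{1Y},\mathcal{T}_{2Y},E)$ is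 the corresponding bi-soft topological space over $Y$. $(X,\mathcal{T}_1,\mathcal{T}_2,E)$ is a pair-wise soft $T_0$-space if for every two distinct points of $X$ there is a $\mathcal{T}_1$-soft open set or a $\mathcal{T}_2$-soft open set which contains one of the two points but not the other. *)

theory Defs
  imports "HOL-Library.FuncSet"
begin

(* A soft set over X with parameter set E is an element of E \<rightarrow>\<^sub>E Pow X: it is undefined outside E,
   so that HOL equality of soft sets is equality of their values at the parameters in E. *)

definition soft_sets :: "'a set \<Rightarrow> 'e set \<Rightarrow> ('e \<Rightarrow> 'a set) set" where
  "soft_sets X E = E \<rightarrow>\<^sub>E Pow X"

definition soft_const :: "'e set \<Rightarrow> 'a set \<Rightarrow> 'e \<Rightarrow> 'a set" where
  "soft_const E A = (\<lambda>e\<in>E. A)"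

definition soft_Union :: "'e set \<Rightarrow> ('e \<Rightarrow> 'a set) set \<Rightarrow> 'e \<Rightarrow> 'a set" where
  "soft_Union E S = (\<lambda>e\<in>E. \<Union>F\<in>S. F e)"

definition soft_inter :: "'e set \<Rightarrow> ('e \<Rightarrow> 'a set) \<Rightarrow> ('e \<Rightarrow> 'a set) \<Rightarrow> 'e \<Rightarrow> 'a set" where
  "soft_inter E F G = (\<lambda>e\<in>E. F e \<inter> G e)"

definition soft_mem :: "'e set \<Rightarrow> 'a \<Rightarrow> ('e \<Rightarrow> 'a set) \<Rightarrow> bool" where
  "soft_mem E x F \<longleftrightarrow> (\<forall>e\<in>E. x \<in> F e)"

definition soft_topology :: "'a set \<Rightarrow> ('e \<Rightarrow> 'a set) set \<Rightarrow> 'e set \<Rightarrow> bool" where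
  "soft_topology X T E \<longleftrightarrow>
     T \<subseteq> soft_sets X E \<and>
     soft_const E {} \<in> T \<and>
     soft_const E X \<in> T \<and>
     (\<forall>S. S \<subseteq> T \<longrightarrow> soft_Union E S \<in> T) \<and>
     (\<forall>F\<in>T. \<forall>G\<in>T. soft_inter E F G \<in> T)"

definition bisoft_topological_space ::
    "'a set \<Rightarrow> ('e \<Rightarrow> 'a set) set \<Rightarrow> ('e \<Rightarrow> 'a set) set \<Rightarrow> 'e set \<Rightarrow> bool" where
  "bisoft_topological_space X T1 T2 E \<longleftrightarrow>
     E \<noteq> {} \<and> soft_topology X T1 E \<and> soft_topology X T2 E"

definition soft_restrict :: "'e set \<Rightarrow> 'a set \<Rightarrow> ('e \<Rightarrow> 'a set) \<Rightarrow> 'e \<Rightarrow> 'a set" where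
  "soft_restrict E Y F = (\<lambda>e\<in>E. Y \<inter> F e)"

definition soft_relative_topology ::
    "'e set \<Rightarrow> 'a set \<Rightarrow> ('e \<Rightarrow> 'a set) set \<Rightarrow> ('e \<Rightarrow> 'a set) set" where
  "soft_relative_topology E Y T = {soft_restrict E Y F | F. F \<in> T}"

definition pairwise_soft_T0_space ::
    "'a set \<Rightarrow> ('e \<Rightarrow> 'a set) set \<Rightarrow> ('e \<Rightarrow> 'a set) set \<Rightarrow> 'e set \<Rightarrow> bool" where
  "pairwise_soft_T0_space X T1 T2 E \<longleftrightarrow>
     bisoft_topological_space X T1 T2 E \<and>
     (\<forall>x\<in>X. \<forall>y\<in>X. x \<noteq> y \<longrightarrow>
        (\<exists>F. (F \<in> T1 \<or> F \<in> T2) \<and>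
             (soft_mem E x F \<and> \<not> soft_mem E y F \<or> soft_mem E y F \<and> \<not> soft_mem E x F)))"

end

theory Submission imports Defs
begin

text \<open>
  Restriction to \<open>Y\<close> is, parameter by parameter, the map \<open>A \<mapsto> Y \<inter> A\<close>. This map commutes with
  unions and binary intersections, so it carries a soft topology on \<open>X\<close> to one on \<open>Y\<close>; and it does
  not change which points \<open>x \<in> Y\<close> belong to a soft set, because \<open>x \<in> Y \<inter> F e\<close> iff \<open>x \<in> F e\<close>. Hence
  a soft open set that separates two points of \<open>Y\<close> in \<open>X\<close> restricts to a relatively soft open set,
  of the same one of the two topologies, that separates them in the same direction.
\<close>

lemma soft_mem_soft_restrict_iff:
  assumes "x \<in> Y"
  shows "soft_mem E x (soft_restrict E Y F) \<longleftrightarrow> soft_mem E x F"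
  using assms by (simp add: soft_mem_def soft_restrict_def)

lemma soft_restrict_soft_const:
  "soft_restrict E Y (soft_const E A) = soft_const E (Y \<inter> A)"
  by (rule ext) (simp add: soft_restrict_def soft_const_def)

lemma soft_restrict_soft_Union:
  "soft_restrict E Y (soft_Union E S) = soft_Union E (soft_restrict E Y ` S)"
  by (rule ext) (simp add: soft_restrict_def soft_Union_def)

lemma soft_restrict_soft_inter:
  "soft_restrict E Y (soft_inter E F G) =
    soft_inter E (soft_restrict E Y F) (soft_restrict E Y G)"
  by (rule ext) (auto simp: soft_restrict_def soft_inter_def)

lemma soft_relative_topology_eq_image:
  "soft_relative_topology E Y T = soft_restrict E Y ` T"
  by (auto simp: soft_relative_topology_def)

lemma soft_topology_soft_relative_topology:
  assumes T: "soft_topology X T E" and "Y \<subseteq> X"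
  shows "soft_topology Y (soft_relative_topology E Y T) E"
  unfolding soft_topology_def soft_relative_topology_eq_image
proof (intro conjI allI impI ballI)
  show "soft_restrict E Y ` T \<subseteq> soft_sets Y E"
    by (auto simp: soft_sets_def soft_restrict_def)
  have "soft_restrict E Y (soft_const E {}) \<in> soft_restrict E Y ` T"
    using T by (auto simp: soft_topology_def)
  then show "soft_const E {} \<in> soft_restrict E Y ` T"
    by (simp add: soft_restrict_soft_const)
  have "soft_restrict E Y (soft_const E X) \<in> soft_restrict E Y ` T"
    using T by (auto simp: soft_topology_def)
  then show "soft_const E Y \<in> soft_restrict E Y ` T"
    using \<open>Y \<subseteq> X\<close> by (simp add: soft_restrict_soft_const Int_absorb2)
next
  fix S assume "S \<subseteq> soft_restrict E Y ` T"
  then obtain S' where "S' \<subseteq> T" and S: "S = soft_restrict E Y ` S'"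
    by (auto simp: subset_image_iff)
  from \<open>S' \<subseteq> T\<close> have "soft_Union E S' \<in> T"
    using T by (simp add: soft_topology_def)
  then show "soft_Union E S \<in> soft_restrict E Y ` T"
    unfolding S soft_restrict_soft_Union [symmetric] by (rule imageI)
next
  fix F G assume "F \<in> soft_restrict E Y ` T" "G \<in> soft_restrict E Y ` T"
  then show "soft_inter E F G \<in> soft_restrict E Y ` T"
    using T by (auto simp: soft_topology_def soft_restrict_soft_inter [symmetric])
qed

theorem proposition6:
  fixes X Y :: "'a set" and E :: "'e set" and T1 T2 :: "('e \<Rightarrow> 'a set) set"
  assumes "bisoft_topological_space X T1 T2 E"
    and "Y \<noteq> {}" and "Y \<subseteq> X"
    and "pairwise_soft_T0_space X T1 T2 E"
  shows "pairwise_soft_T0_space Y (soft_relative_topology E Y T1) (soft_relative_topology E Y T2) E"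
  unfolding pairwise_soft_T0_space_def
proof (intro conjI ballI impI)
  show "bisoft_topological_space Y (soft_relative_topology E Y T1) (soft_relative_topology E Y T2) E"
    using assms(1,3)
    by (auto simp: bisoft_topological_space_def intro: soft_topology_soft_relative_topology)
next
  fix x y assume "x \<in> Y" "y \<in> Y" "x \<noteq> y"
  then obtain F where "F \<in> T1 \<or> F \<in> T2"
    and "soft_mem E x F \<and> \<not> soft_mem E y F \<or> soft_mem E y F \<and> \<not> soft_mem E x F"
    using assms(3,4) unfolding pairwise_soft_T0_space_def by blast
  then show "\<exists>F. (F \<in> soft_relative_topology E Y T1 \<or> F \<in> soft_relative_topology E Y T2) \<and>
      (soft_mem E x F \<and> \<not> soft_mem E y F \<or> soft_mem E y F \<and> \<not> soft_mem E x F)"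
    using \<open>x \<in> Y\<close> \<open>y \<in> Y\<close>
    by (intro exI [of _ "soft_restrict E Y F"])
      (auto simp: soft_relative_topology_eq_image soft_mem_soft_restrict_iff)
qed

end
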